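(* Let $t\ge 2$ be an integer and let $S_t=K_{t-1,1}$ be the star graph on $t$ vertices. If $\Gamma$ is a finite simple graph with $A(\Gamma;x)=A(S_t;x)$, then $\Gamma$ is isomorphic to $S_t$.
   Context: All graphs are finite and simple with at least one vertex. For a graph $\Gamma=(V,E)$ of order $n$, a vertex $v$ and $X\subseteq V$, let $\delta_X(v)$ be the number of neighbours of $v$ in $X$, $\delta_1$ the maximum degree, and $\bar S=V\setminus S$. Let $\mathcal{K}=[-\delta_1,\delta_1]\cap\mathbb{Z}$. A nonempty $S\subseteq V$ is a defensive $k$-alliance if $\delta_S(v)\ge\delta_{\bar S}(v)+k$ for all $v\in S$. The exact index of alliance of a nonempty $S$ is $k_S=\max\{k\in\mathcal{K}: S \text{ is a defensive } k\text{-alliance}\}$ (equivalently $k_S=\min_{v\in S}(\delta_S(v)-\delta_{\bar S}(v))$). The alliance polynomial is $A(\Gamma;x)=\sum_{S} x^{n+k_S}$, the sum over all nonempty $S\subseteq V$ whose induced subgraph $\langle S\rangle$ is connected. *)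

theory Defs
  imports
    "Graph_Theory.Graph_Theory"
    "HOL-Computational_Algebra.Polynomial"
begin

text \<open>
  Finite simple graphs are rendered by the locale \<open>graph\<close> of \<open>Graph_Theory\<close>, i.e. as finite,
  loop-free symmetric digraphs without parallel arcs: an undirected edge corresponds to a pair of
  opposite arcs, and the neighbours of \<open>v\<close> are the \<open>u\<close> with \<open>v \<rightarrow>\<^bsub>G\<^esub> u\<close>.
\<close>

definition degree_in :: "('a, 'b) pre_digraph \<Rightarrow> 'a set \<Rightarrow> 'a \<Rightarrow> nat" where
  "degree_in G X v = card {u \<in> X. v \<rightarrow>\<^bsub>G\<^esub> u}"

definition max_degree :: "('a, 'b) pre_digraph \<Rightarrow> nat" where
  "max_degree G = Max (degree_in G (verts G) ` verts G)"

definition defensive_alliance :: "('a, 'b) pre_digraph \<Rightarrow> int \<Rightarrow> 'a set \<Rightarrow> bool" where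
  "defensive_alliance G k S \<longleftrightarrow> S \<noteq> {} \<and> S \<subseteq> verts G \<and>
     (\<forall>v\<in>S. int (degree_in G S v) \<ge> int (degree_in G (verts G - S) v) + k)"

definition exact_index :: "('a, 'b) pre_digraph \<Rightarrow> 'a set \<Rightarrow> int" where
  "exact_index G S =
     Max {k \<in> {- int (max_degree G) .. int (max_degree G)}. defensive_alliance G k S}"

text \<open>
  The exponent \<open>n + k\<^sub>S\<close> is positive, since \<open>k\<^sub>S \<ge> - \<delta>\<^sub>1 > - n\<close>, so \<^const>\<open>nat\<close> does not truncate
  (see \<open>exponent_pos\<close> below). The qualified name distinguishes connectedness of graphs from
  topological connectedness.
\<close>
definition alliance_poly :: "('a, 'b) pre_digraph \<Rightarrow> int poly" where
  "alliance_poly G =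
     (\<Sum>S | S \<noteq> {} \<and> S \<subseteq> verts G \<and> Digraph_Component.connected (G \<restriction> S).
        monom 1 (nat (int (card (verts G)) + exact_index G S)))"

text \<open>The star on the \<open>t\<close> vertices \<open>0, \<dots>, t - 1\<close>, with centre \<open>0\<close>.\<close>
definition star_graph :: "nat \<Rightarrow> nat pair_pre_digraph" where
  "star_graph t = \<lparr> pverts = {0..<t}, parcs = {1..<t} \<times> {0} \<union> {0} \<times> {1..<t} \<rparr>"

lemma star_graph_complete_bipartite:
  assumes "t \<ge> 1"
  shows "K\<^bsub>t - 1, 1\<^esub> (with_proj (star_graph t))"
proof -
  have "pverts (star_graph t) = {1..<t} \<union> {0}" "{1..<t} \<inter> {0} = {}"
    using assms by (auto simp: star_graph_def)
  moreover have "parcs (star_graph t) = {1..<t} \<times> {0} \<union> {0} \<times> {1..<t}"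
    by (simp add: star_graph_def)
  moreover have "card {1..<t} = t - 1" "card {0::nat} = 1" by simp_all
  moreover have "finite (pverts (star_graph t))" by (simp add: star_graph_def)
  ultimately show ?thesis unfolding complete_bipartite_digraph_pair_def by blast
qed

lemma (in graph) degree_in_add_compl:
  assumes "S \<subseteq> verts G"
  shows "degree_in G S v + degree_in G (verts G - S) v = degree_in G (verts G) v"
proof -
  have "{u \<in> verts G. v \<rightarrow>\<^bsub>G\<^esub> u} = {u \<in> S. v \<rightarrow>\<^bsub>G\<^esub> u} \<union> {u \<in> verts G - S. v \<rightarrow>\<^bsub>G\<^esub> u}"
    using assms by auto
  moreover have "card ({u \<in> S. v \<rightarrow>\<^bsub>G\<^esub> u} \<union> {u \<in> verts G - S. v \<rightarrow>\<^bsub>G\<^esub> u}) =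
      card {u \<in> S. v \<rightarrow>\<^bsub>G\<^esub> u} + card {u \<in> verts G - S. v \<rightarrow>\<^bsub>G\<^esub> u}"
    using finite_subset[OF assms finite_verts] by (intro card_Un_disjoint) auto
  ultimately show ?thesis by (simp add: degree_in_def)
qed

lemma (in graph) degree_in_le_max_degree:
  "v \<in> verts G \<Longrightarrow> degree_in G (verts G) v \<le> max_degree G"
  by (simp add: max_degree_def)

lemma (in graph) exact_index_eq_Min:
  assumes "S \<noteq> {}" "S \<subseteq> verts G"
  shows "exact_index G S =
    Min ((\<lambda>v. int (degree_in G S v) - int (degree_in G (verts G - S) v)) ` S)"
    (is "_ = Min (?f ` S)")
proof -
  have fin: "finite S" using finite_subset[OF assms(2) finite_verts] .
  then have ne: "finite (?f ` S)" "?f ` S \<noteq> {}" using assms by auto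
  from Min_in[OF ne] obtain v where v: "v \<in> S" "Min (?f ` S) = ?f v" by auto
  have "degree_in G (verts G) v \<le> max_degree G"
    using v assms degree_in_le_max_degree by auto
  then have rng: "Min (?f ` S) \<in> {- int (max_degree G) .. int (max_degree G)}"
    using degree_in_add_compl[OF assms(2), of v] v by simp
  have "defensive_alliance G k S \<longleftrightarrow> k \<le> Min (?f ` S)" for k
    using assms ne by (auto simp: defensive_alliance_def le_diff_eq algebra_simps)
  with rng show ?thesis
    unfolding exact_index_def by (intro Max_eqI) (auto intro: finite_subset[OF _ finite_atLeastAtMost_int])
qed

lemma (in graph) exponent_pos:
  assumes "S \<noteq> {}" "S \<subseteq> verts G"
  shows "int (card (verts G)) + exact_index G S > 0"
proof -
  have fin: "finite S" using finite_subset[OF assms(2) finite_verts] .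
  then have ne: "finite ((\<lambda>v. int (degree_in G S v) - int (degree_in G (verts G - S) v)) ` S)"
    "(\<lambda>v. int (degree_in G S v) - int (degree_in G (verts G - S) v)) ` S \<noteq> {}"
    using assms by auto
  from Min_in[OF ne] exact_index_eq_Min[OF assms] obtain v where v: "v \<in> S"
    "exact_index G S = int (degree_in G S v) - int (degree_in G (verts G - S) v)" by auto
  have "{u \<in> verts G - S. v \<rightarrow>\<^bsub>G\<^esub> u} \<subset> verts G" using v assms by auto
  then have "degree_in G (verts G - S) v < card (verts G)"
    unfolding degree_in_def by (intro psubset_card_mono) auto
  with v show ?thesis by simp
qed

end

theory Submission
  imports Defs
begin

text \<open>
  The term of degree 1 in \<open>A(S\<^sub>t; x)\<close> forces \<open>k\<^sub>S = 1 - n\<close> for some \<open>S\<close>, so a vertex \<open>c\<close> of \<open>\<Gamma>\<close> has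
  no neighbours in \<open>S\<close> and \<open>n - 1\<close> outside, i.e. it is adjacent to all others. Hence all sets
  containing \<open>c\<close> and all singletons are connected, which are \<open>2\<^bsup>n-1\<^esup> + n - 1\<close> sets, with equality iff
  every edge is incident to \<open>c\<close>. On the other hand \<open>A(\<Gamma>; 1)\<close>, the number of connected sets, equals
  \<open>2\<^bsup>t-1\<^esup> + t - 1\<close>. The lower bound gives \<open>n \<le> t\<close>, and since there are at most \<open>2\<^bsup>n\<^esup> - 1\<close> nonempty sets,
  also \<open>n \<ge> t\<close>. So equality holds and \<open>\<Gamma>\<close> is a star.
\<close>

definition connected_sets :: "('a, 'b) pre_digraph \<Rightarrow> 'a set set" where
  "connected_sets G = {S. S \<noteq> {} \<and> S \<subseteq> verts G \<and> Digraph_Component.connected (G \<restriction> S)}"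

text \<open>These will turn out to be the connected sets of a star on \<open>V\<close> with centre
  \<open>c\<close>. The singleton \<open>{c}\<close> occurs only in the first part, so the union is
  disjoint and easy to count.\<close>

definition star_sets :: "'a set \<Rightarrow> 'a \<Rightarrow> 'a set set" where
  "star_sets V c = insert c ` Pow (V - {c}) \<union> (\<lambda>v. {v}) ` (V - {c})"

lemma card_star_sets:
  assumes "finite V" "c \<in> V"
  shows "card (star_sets V c) = 2 ^ (card V - 1) + (card V - 1)"
proof -
  have "card (star_sets V c) = card (insert c ` Pow (V - {c})) + card ((\<lambda>v. {v}) ` (V - {c}))"
    unfolding star_sets_def using assms by (intro card_Un_disjoint) auto
  moreover have "inj_on (insert c) (Pow (V - {c}))"
    by (rule inj_onI) auto
  moreover have "inj_on (\<lambda>v. {v}) (V - {c})"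
    by (rule inj_onI) auto
  ultimately show ?thesis
    using assms by (simp add: card_image card_Pow)
qed

section \<open>Connectedness of induced subgraphs\<close>

lemma arcs_ends_induce_iff:
  "u \<rightarrow>\<^bsub>G \<restriction> S\<^esub> v \<longleftrightarrow> u \<rightarrow>\<^bsub>G\<^esub> v \<and> u \<in> S \<and> v \<in> S"
  by (auto simp: arcs_ends_conv induce_subgraph_def)

text \<open>The vertex \<open>w\<close> is the second one on a walk from \<open>u\<close> to
  \<open>v\<close>. The walk runs in the symmetric closure, hence the two possible directions of the
  arc.\<close>

lemma connected_induce_neighbour:
  assumes "Digraph_Component.connected (G \<restriction> S)" "u \<in> S" "v \<in> S" "u \<noteq> v"
  obtains w where "w \<in> S" "u \<rightarrow>\<^bsub>G\<^esub> w \<or> w \<rightarrow>\<^bsub>G\<^esub> u"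
proof -
  have "(u, v) \<in> rtrancl_on S ((arcs_ends (G \<restriction> S))\<^sup>s)"
    using assms by (auto simp: connected_conv)
  then show thesis
    using assms(4) that
    by (cases rule: converse_rtrancl_on_cases) (auto simp: symcl_def arcs_ends_induce_iff)
qed

text \<open>Any two vertices are joined through \<open>c\<close>. This covers singletons, where the
  condition on arcs is vacuous, and the two ends of an edge.\<close>

lemma connected_induce_cone:
  assumes "c \<in> S" "\<And>v. v \<in> S \<Longrightarrow> v \<noteq> c \<Longrightarrow> c \<rightarrow>\<^bsub>G\<^esub> v"
  shows "Digraph_Component.connected (G \<restriction> S)"
proof -
  let ?R = "rtrancl_on S ((arcs_ends (G \<restriction> S))\<^sup>s)"
  have arc: "(c, v) \<in> (arcs_ends (G \<restriction> S))\<^sup>s \<and> (v, c) \<in> (arcs_ends (G \<restriction> S))\<^sup>s"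
    if "v \<in> S" "v \<noteq> c" for v
    using assms that by (auto simp: symcl_def arcs_ends_induce_iff)
  have "(c, v) \<in> ?R \<and> (v, c) \<in> ?R" if "v \<in> S" for v
    using arc[OF that] that assms(1)
    by (cases "v = c")
      (auto intro: rtrancl_on_into_rtrancl_on converse_rtrancl_on_into_rtrancl_on rtrancl_on_refl)
  then have "(u, v) \<in> ?R" if "u \<in> S" "v \<in> S" for u v
    using that by (blast intro: rtrancl_on_trans)
  then show ?thesis
    using assms(1) by (auto simp: connected_conv)
qed

section \<open>The polynomial as a count of connected sets\<close>

lemma poly_alliance_poly_1: "poly (alliance_poly G) 1 = int (card (connected_sets G))"
  by (simp add: alliance_poly_def connected_sets_def poly_sum poly_monom)

context graph
begin

lemma finite_connected_sets: "finite (connected_sets G)"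
  by (rule finite_subset[of _ "Pow (verts G)"]) (auto simp: connected_sets_def)

lemma coeff_alliance_poly:
  "coeff (alliance_poly G) j =
    int (card {S \<in> connected_sets G. nat (int (card (verts G)) + exact_index G S) = j})"
  using finite_connected_sets
  by (simp add: alliance_poly_def coeff_sum if_distrib sum.If_cases Int_def
      flip: connected_sets_def)

section \<open>Connected sets versus a centre\<close>

lemma star_sets_subset_connected_sets:
  assumes "c \<in> verts G" "\<And>v. v \<in> verts G \<Longrightarrow> v \<noteq> c \<Longrightarrow> c \<rightarrow> v"
  shows "star_sets (verts G) c \<subseteq> connected_sets G"
proof
  fix S assume "S \<in> star_sets (verts G) c"
  then consider "c \<in> S" "S \<subseteq> verts G" | v where "S = {v}" "v \<in> verts G"
    using assms(1) by (auto simp: star_sets_def)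
  then show "S \<in> connected_sets G"
  proof cases
    case 1
    then show ?thesis
      using assms(2) connected_induce_cone[of c S G] by (auto simp: connected_sets_def)
  next
    case 2
    then show ?thesis
      using connected_induce_cone[of v S G] by (auto simp: connected_sets_def)
  qed
qed

text \<open>A set avoiding \<open>c\<close> induces no arcs, so it is connected only as a
  singleton.\<close>

lemma connected_sets_subset_star_sets:
  assumes "\<And>u v. u \<rightarrow> v \<Longrightarrow> u = c \<or> v = c"
  shows "connected_sets G \<subseteq> star_sets (verts G) c"
proof
  fix S assume "S \<in> connected_sets G"
  then have S: "S \<noteq> {}" "S \<subseteq> verts G" "Digraph_Component.connected (G \<restriction> S)"
    by (auto simp: connected_sets_def)
  show "S \<in> star_sets (verts G) c"
  proof (cases "c \<in> S")
    case True
    then have "S = insert c (S - {c})" by auto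
    then show ?thesis using S(2) unfolding star_sets_def by blast
  next
    case False
    obtain u where u: "u \<in> S" using S(1) by blast
    have "v = u" if "v \<in> S" for v
    proof (rule ccontr)
      assume "v \<noteq> u"
      then obtain w where "w \<in> S" "u \<rightarrow> w \<or> w \<rightarrow> u"
        using connected_induce_neighbour[OF S(3) u \<open>v \<in> S\<close>] by metis
      then show False using assms u False by blast
    qed
    then have "S = {u}" using u by blast
    then show ?thesis using u S(2) False by (auto simp: star_sets_def)
  qed
qed

text \<open>The ends of an arc avoiding \<open>c\<close> would form a connected set that neither
  contains \<open>c\<close> nor is a singleton.\<close>

lemma arc_incident_if_connected_sets_eq:
  assumes "connected_sets G = star_sets (verts G) c" "u \<rightarrow> v"
  shows "u = c \<or> v = c"
proof (rule ccontr)
  assume "\<not> (u = c \<or> v = c)"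
  moreover have "u \<noteq> v" using assms(2) adj_not_same by blast
  ultimately have "{u, v} \<notin> star_sets (verts G) c"
    by (auto simp: star_sets_def doubleton_eq_iff)
  moreover have "Digraph_Component.connected (G \<restriction> {u, v})"
    using assms(2) by (intro connected_induce_cone[of u]) auto
  then have "{u, v} \<in> connected_sets G"
    using adj_in_verts[OF assms(2)] by (auto simp: connected_sets_def)
  ultimately show False using assms(1) by simp
qed

section \<open>Recovering the star\<close>

lemma dominating_vertex:
  assumes "S \<noteq> {}" "S \<subseteq> verts G" "int (card (verts G)) + exact_index G S = 1"
  obtains c where "c \<in> verts G" "\<And>v. v \<in> verts G \<Longrightarrow> v \<noteq> c \<Longrightarrow> c \<rightarrow> v"
proof -
  let ?f = "\<lambda>v. int (degree_in G S v) - int (degree_in G (verts G - S) v)"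
  have "finite S" using finite_subset[OF assms(2) finite_verts] .
  then have "Min (?f ` S) \<in> ?f ` S" using assms(1) by (intro Min_in) auto
  then obtain c where c: "c \<in> S" "exact_index G S = ?f c"
    using exact_index_eq_Min[OF assms(1,2)] by auto
  let ?N = "{u \<in> verts G - S. c \<rightarrow> u}"
  have "card (verts G - {c}) = card (verts G) - 1"
    using c assms(2) by auto
  \<comment> \<open>At \<open>c\<close> the outside degree exceeds the inside degree by
    \<open>card (verts G) - 1\<close>, so it is at least that large.\<close>
  then have "card (verts G - {c}) \<le> card ?N"
    using assms(3) c by (simp add: degree_in_def)
  moreover have "?N \<subseteq> verts G - {c}" using c by auto
  ultimately have "?N = verts G - {c}"
    by (intro card_seteq) auto
  then show thesis using that c assms(2) by blast
qed

lemma digraph_iso_star_graph: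
  assumes "c \<in> verts G" "\<And>v. v \<in> verts G \<Longrightarrow> v \<noteq> c \<Longrightarrow> c \<rightarrow> v"
    and "\<And>u v. u \<rightarrow> v \<Longrightarrow> u = c \<or> v = c"
  shows "digraph_iso G (with_proj (star_graph (card (verts G))))"
proof -
  let ?n = "card (verts G)"
  have n: "?n > 0" using assms(1) by (auto simp: card_gt_0_iff)
  have "\<exists>g. bij_betw g (verts G - {c}) {1..<?n}"
    using assms(1) by (intro finite_same_card_bij) auto
  then obtain g where g: "bij_betw g (verts G - {c}) {1..<?n}" ..
  define f where "f = g(c := 0)"
  have fc: "f c = 0" by (simp add: f_def)
  have img: "f ` (verts G - {c}) = {1..<?n}"
    using g by (auto simp: f_def bij_betw_def)
  have "inj_on f (verts G - {c})"
    using g by (auto simp: f_def bij_betw_def inj_on_def)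
  then have inj: "inj_on f (insert c (verts G - {c}))"
    using img fc by (subst inj_on_insert) auto
  then have inj: "inj_on f (verts G)"
    using assms(1) by (simp add: insert_absorb)
  have "f ` verts G = insert 0 {1..<?n}"
    using img fc assms(1) by (metis image_insert insert_Diff)
  then have vimg: "f ` verts G = {0..<?n}"
    using n by auto
  have ends: "arcs_ends G = {c} \<times> (verts G - {c}) \<union> (verts G - {c}) \<times> {c}"
  proof (intro set_eqI iffI; clarify)
    fix u v assume uv: "u \<rightarrow> v" "\<not> (u \<in> verts G - {c} \<and> v \<in> {c})"
    then show "u \<in> {c} \<and> v \<in> verts G - {c}"
      using assms(3)[OF uv(1)] adj_in_verts[OF uv(1)] adj_not_same by blast
  next
    fix u v assume "(u, v) \<in> {c} \<times> (verts G - {c}) \<union> (verts G - {c}) \<times> {c}"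
    then show "u \<rightarrow> v"
      using assms(2) arcs_ends_symmetric[OF sym_arcs] by auto
  qed
  \<comment> \<open>Arcs of \<open>G\<close> have an arbitrary type, so each is sent to the pair of
    images of its ends; this is injective because there are no parallel arcs. With
    \<open>fst\<close> and \<open>snd\<close> as tail and head, the image of \<open>G\<close> is
    literally the star.\<close>
  define h where "h = \<lparr>iso_verts = f, iso_arcs = \<lambda>a. (f (tail G a), f (head G a)),
    iso_head = snd, iso_tail = fst\<rparr>"
  have "inj_on (iso_arcs h) (arcs G)"
  proof (rule inj_onI)
    fix a b assume ab: "a \<in> arcs G" "b \<in> arcs G" "iso_arcs h a = iso_arcs h b"
    then have "arc_to_ends G a = arc_to_ends G b"
      using inj by (auto simp: h_def arc_to_ends_def dest: inj_onD)
    then show "a = b" using ab no_multi_arcs by blast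
  qed
  then have "digraph_isomorphism h"
    using inj by (auto simp: digraph_isomorphism_def h_def wf_digraph)
  moreover have "iso_arcs h ` arcs G = map_prod f f ` arcs_ends G"
    by (auto simp: h_def arcs_ends_conv image_image)
  then have "iso_arcs h ` arcs G = parcs (star_graph ?n)"
    by (simp add: ends image_Un map_prod_surj_on img fc star_graph_def Un_commute
        flip: image_paired_Times)
  then have "with_proj (star_graph ?n) = app_iso h G"
    by (simp add: app_iso_def with_proj_def h_def vimg star_graph_def)
  ultimately show ?thesis unfolding digraph_iso_def by blast
qed

end

section \<open>The polynomial of the star\<close>

lemma graph_star_graph: "graph (with_proj (star_graph t))"
proof -
  have "pair_graph (star_graph t)"
    by unfold_locales
      (auto simp: star_graph_def symmetric_def sym_def)
  then show ?thesis by (rule pair_graph.pair_graphD_graph)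
qed

lemma connected_sets_star_graph:
  assumes "t \<ge> 1"
  shows "connected_sets (with_proj (star_graph t)) = star_sets {0..<t} 0"
proof -
  interpret S: graph "with_proj (star_graph t)" by (rule graph_star_graph)
  have "connected_sets (with_proj (star_graph t)) = star_sets (verts (with_proj (star_graph t))) 0"
    using assms S.star_sets_subset_connected_sets[of 0] S.connected_sets_subset_star_sets[of 0]
    by (auto simp: star_graph_def)
  then show ?thesis by (simp add: star_graph_def)
qed

text \<open>The set \<open>{0}\<close> contributes: all \<open>t - 1\<close> neighbours of the
  centre lie outside it, so its index is \<open>1 - t\<close>.\<close>

lemma coeff_1_alliance_poly_star_graph:
  assumes "t \<ge> 1"
  shows "coeff (alliance_poly (with_proj (star_graph t))) 1 \<noteq> 0"
proof -
  let ?S = "with_proj (star_graph t)"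
  interpret S: graph ?S by (rule graph_star_graph)
  have "{0} \<in> connected_sets ?S"
    using assms by (auto simp: connected_sets_star_graph star_sets_def)
  moreover have "{u \<in> {0..<t} - {0}. (0, u) \<in> parcs (star_graph t)} = {1..<t}"
    by (auto simp: star_graph_def)
  then have "int (card (verts ?S)) + exact_index ?S {0} = 1"
    using assms by (subst S.exact_index_eq_Min) (auto simp: degree_in_def star_graph_def)
  ultimately show ?thesis
    unfolding S.coeff_alliance_poly using S.finite_connected_sets by auto
qed

theorem theorem3p15:
  fixes G :: "('a, 'b) pre_digraph" and t :: nat
  assumes "t \<ge> 2"
    and "graph G" and "verts G \<noteq> {}"
    and "alliance_poly G = alliance_poly (with_proj (star_graph t))"
  shows "digraph_iso G (with_proj (star_graph t))"
proof -
  interpret graph G by fact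
  let ?n = "card (verts G)"
  have "coeff (alliance_poly G) 1 \<noteq> 0"
    using coeff_1_alliance_poly_star_graph[of t] assms(1,4) by simp
  then have "card {S \<in> connected_sets G. nat (int ?n + exact_index G S) = 1} \<noteq> 0"
    by (simp add: coeff_alliance_poly)
  then obtain S where "S \<in> connected_sets G" "nat (int ?n + exact_index G S) = 1"
    by (metis (mono_tags, lifting) card.empty empty_Collect_eq)
  then have "S \<noteq> {}" "S \<subseteq> verts G" "int ?n + exact_index G S = 1"
    by (auto simp: connected_sets_def)
  then obtain c where c: "c \<in> verts G" "\<And>v. v \<in> verts G \<Longrightarrow> v \<noteq> c \<Longrightarrow> c \<rightarrow>\<^bsub>G\<^esub> v"
    using dominating_vertex by metis
  have "int (card (connected_sets G)) = int (card (connected_sets (with_proj (star_graph t))))"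
    unfolding poly_alliance_poly_1[symmetric] assms(4) ..
  then have "card (connected_sets G) = card (star_sets {0..<t} 0)"
    using assms(1) by (simp add: connected_sets_star_graph)
  then have count: "card (connected_sets G) = 2 ^ (t - 1) + (t - 1)"
    using assms(1) by (simp add: card_star_sets)
  have sub: "star_sets (verts G) c \<subseteq> connected_sets G"
    using c by (rule star_sets_subset_connected_sets)
  have "?n \<le> t"
  proof (rule ccontr)
    assume "\<not> ?n \<le> t"
    \<comment> \<open>The number of star sets is strictly increasing in the order, so a larger
      \<open>G\<close> would have too many connected sets.\<close>
    then have "2 ^ (t - 1) + (t - 1) < (2::nat) ^ (?n - 1) + (?n - 1)"
      using assms(1) by (intro add_le_less_mono power_increasing) auto
    then show False
      using card_mono[OF finite_connected_sets sub] c(1) count by (simp add: card_star_sets)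
  qed
  moreover have "t \<le> ?n"
  proof (rule ccontr)
    assume "\<not> t \<le> ?n"
    then have "(2::nat) ^ ?n \<le> 2 ^ (t - 1)"
      by (intro power_increasing) auto
    \<comment> \<open>Strict, since the empty set is excluded; the count would then fall below
      \<open>2 ^ (t - 1)\<close>.\<close>
    moreover have "card (connected_sets G) < card (Pow (verts G))"
      by (rule psubset_card_mono) (auto simp: connected_sets_def)
    then have "card (connected_sets G) < 2 ^ ?n"
      by (simp add: card_Pow)
    ultimately show False
      using count by linarith
  qed
  ultimately have n: "?n = t" by simp
  \<comment> \<open>Equal cardinalities turn the inclusion \<open>sub\<close> into an equality,
    which leaves no room for an arc avoiding \<open>c\<close>.\<close>
  then have "star_sets (verts G) c = connected_sets G"
    using c(1) count finite_connected_sets sub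
    by (intro card_subset_eq) (auto simp: card_star_sets)
  then have "digraph_iso G (with_proj (star_graph ?n))"
    using c arc_incident_if_connected_sets_eq[of c] by (intro digraph_iso_star_graph) auto
  then show ?thesis by (simp add: n)
qed

end
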